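(* Let $n,m$ be positive integers with $n/m\le 60$, let $b=m$ and $\rho=1.6$. Then Algorithm Bricks on input $(n,m,b,\rho)$ outputs bag sizes $a_1,\dots,a_b$ with $\sum_{j=1}^b a_j\ge n$.
   Context: Algorithm Bricks (input: number of unit-size jobs $n$, number of machines $m$, number of bags $b$, desired robustness factor $\rho$): set $c\gets n$; for $j=1,\dots,b$: set $z\gets\lceil c/m\rceil$, $a_j\gets\lfloor z\rho\rfloor$, $c\gets c-z$. Return $a_1,\dots,a_b$. (The number $z$ is called the cost of bag $j$.) *)

theory Defs
  imports Complex_Main
begin

(* The loop variable c is an integer, so that c - z is the ordinary, non-truncated difference. *)
fun bricks_loop :: "nat \<Rightarrow> real \<Rightarrow> nat \<Rightarrow> int \<Rightarrow> int list" where
  "bricks_loop m \<rho> 0 c = []"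
| "bricks_loop m \<rho> (Suc k) c =
     (let z = \<lceil>real_of_int c / real m\<rceil>
      in \<lfloor>real_of_int z * \<rho>\<rfloor> # bricks_loop m \<rho> k (c - z))"

definition bricks :: "nat \<Rightarrow> nat \<Rightarrow> nat \<Rightarrow> real \<Rightarrow> int list" where
  "bricks n m b \<rho> = bricks_loop m \<rho> b (int n)"

end

theory Submission
  imports Defs
begin

text \<open>
  Write \<open>f z = \<lfloor>z \<rho>\<rfloor>\<close>, call \<open>\<lceil>x / m\<rceil>\<close> the level of \<open>x\<close>, and let \<open>w\<close> be the level of the final
  value of \<open>c\<close>. Every step of cost \<open>z\<close> is credited with \<open>f w\<close>, and its surplus \<open>f z - f w\<close> is
  distributed over the \<open>z\<close> units it removes from \<open>c\<close>, at most 1 for each unit. These shares increase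
  with the level, although \<open>(f z - f w) / z\<close> itself need not. Since the units removed at cost \<open>z\<close> have
  level at most \<open>z\<close>, the surplus covers the shares of their own levels, so rounding never hurts,
  and the sum of the bag sizes is at least \<open>m * f w\<close> plus the shares of all \<open>n\<close> units. As no share
  exceeds 1, the worst case is \<open>n = 60 * m\<close>, which leaves a numerical inequality for each \<open>w \<le> 60\<close>.
\<close>

section \<open>Shares of the surplus and their monotonicity in the level\<close>

definition share :: "real \<Rightarrow> int \<Rightarrow> int \<Rightarrow> real" where
  "share \<rho> w z =
     max 0 (min 1 (real_of_int (\<lfloor>real_of_int z * \<rho>\<rfloor> - \<lfloor>real_of_int w * \<rho>\<rfloor>) / real_of_int z))"

definition potential :: "real \<Rightarrow> nat \<Rightarrow> int \<Rightarrow> int \<Rightarrow> real" where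
  "potential \<rho> m w c = (\<Sum>x\<in>{1..c}. share \<rho> w \<lceil>real_of_int x / real m\<rceil>)"

lemma share_le_1: "share \<rho> w z \<le> 1"
  by (simp add: share_def)

lemma floor_mult_mono:
  fixes \<rho> :: real
  assumes "0 \<le> \<rho>" "w \<le> z"
  shows "\<lfloor>real_of_int w * \<rho>\<rfloor> \<le> \<lfloor>real_of_int z * \<rho>\<rfloor>"
  using assms by (intro floor_mono mult_right_mono) auto

lemma share_eq_0:
  assumes "0 \<le> \<rho>" "0 \<le> z" "z \<le> w"
  shows "share \<rho> w z = 0"
proof -
  have "real_of_int (\<lfloor>real_of_int z * \<rho>\<rfloor> - \<lfloor>real_of_int w * \<rho>\<rfloor>) / real_of_int z \<le> 0"
    using floor_mult_mono[OF assms(1,3)] assms(2) by (intro divide_nonpos_nonneg) auto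
  then show ?thesis by (simp add: share_def)
qed

text \<open>As \<open>w \<le> z\<close>, the surplus is nonnegative, so the clipping at 0 adds
  nothing and the clipping at 1 only lowers the quotient.\<close>

lemma share_surplus:
  assumes "0 \<le> \<rho>" "0 \<le> w" "w \<le> z"
  shows "real_of_int z * share \<rho> w z
    \<le> real_of_int \<lfloor>real_of_int z * \<rho>\<rfloor> - real_of_int \<lfloor>real_of_int w * \<rho>\<rfloor>"
proof (cases "z = 0")
  case True
  then show ?thesis using assms by simp
next
  case False
  then have z: "0 < real_of_int z" using assms by simp
  define d where "d = real_of_int (\<lfloor>real_of_int z * \<rho>\<rfloor> - \<lfloor>real_of_int w * \<rho>\<rfloor>)"
  have "0 \<le> d" using floor_mult_mono[OF assms(1,3)] by (simp add: d_def)
  then have "share \<rho> w z \<le> d / real_of_int z"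
    unfolding share_def d_def[symmetric] using z by simp
  then have "real_of_int z * share \<rho> w z \<le> d"
    using z by (simp add: field_simps)
  then show ?thesis by (simp add: d_def)
qed

text \<open>Since \<open>1 \<le> \<rho>\<close>, passing from \<open>z\<close> to
  \<open>z + 1\<close> raises the numerator by at least 1. Adding 1 to numerator and denominator
  does not lower a quotient that is at most 1; a larger quotient stays above 1 and is capped, which
  is why \<open>share\<close> contains \<open>min 1\<close>.\<close>

lemma share_step:
  assumes "1 \<le> \<rho>" "0 < z"
  shows "share \<rho> w z \<le> share \<rho> w (z + 1)"
proof -
  define a where "a = real_of_int (\<lfloor>real_of_int z * \<rho>\<rfloor> - \<lfloor>real_of_int w * \<rho>\<rfloor>)"
  define b where "b = real_of_int (\<lfloor>real_of_int (z + 1) * \<rho>\<rfloor> - \<lfloor>real_of_int w * \<rho>\<rfloor>)"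
  define y where "y = real_of_int z"
  have y: "0 < y" using assms by (simp add: y_def)
  have "\<lfloor>real_of_int z * \<rho> + 1\<rfloor> \<le> \<lfloor>real_of_int (z + 1) * \<rho>\<rfloor>"
    using assms by (intro floor_mono) (simp add: algebra_simps)
  then have ab: "a + 1 \<le> b" by (simp add: a_def b_def)
  have "max 0 (min 1 (a / y)) \<le> max 0 (min 1 (b / (y + 1)))"
  proof (cases "a \<le> y")
    case True
    have "a / y \<le> (a + 1) / (y + 1)" using True y by (simp add: field_simps)
    also have "\<dots> \<le> b / (y + 1)" using ab y by (intro divide_right_mono) auto
    finally show ?thesis by linarith
  next
    case False
    then have "1 \<le> b / (y + 1)" using ab y by (simp add: field_simps)
    then show ?thesis by linarith
  qed
  then show ?thesis by (simp add: share_def a_def b_def y_def)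
qed

lemma share_mono:
  assumes "1 \<le> \<rho>" "0 < y" "y \<le> z"
  shows "share \<rho> w y \<le> share \<rho> w z"
  using assms(3)
proof (induction z rule: int_ge_induct)
  case (step z)
  then show ?case using share_step[of \<rho> z w] assms by linarith
qed simp

section \<open>The potential: its decrease along the loop and its size\<close>

lemma potential_step:
  assumes "1 \<le> \<rho>" "0 < m" "0 \<le> z" "z \<le> c" "z = \<lceil>real_of_int c / real m\<rceil>"
  shows "potential \<rho> m w c \<le> real_of_int z * share \<rho> w z + potential \<rho> m w (c - z)"
proof -
  let ?h = "\<lambda>x. share \<rho> w \<lceil>real_of_int x / real m\<rceil>"
  have "{1..c} = {1..c - z} \<union> {c - z + 1..c}" using assms(3,4) by auto
  then have "potential \<rho> m w c = potential \<rho> m w (c - z) + sum ?h {c - z + 1..c}"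
    unfolding potential_def by (simp add: sum.union_disjoint)
  \<comment> \<open>The removed units are the top \<open>z\<close> ones. Their levels lie between 1
    and \<open>z\<close>, so monotonicity bounds each share by that of level
    \<open>z\<close>.\<close>
  moreover have "sum ?h {c - z + 1..c} \<le> real (card {c - z + 1..c}) * share \<rho> w z"
  proof (rule sum_bounded_above)
    fix x assume x: "x \<in> {c - z + 1..c}"
    then have "0 < \<lceil>real_of_int x / real m\<rceil>" using assms by simp
    moreover have "\<lceil>real_of_int x / real m\<rceil> \<le> z"
      unfolding assms(5) using x by (intro ceiling_mono divide_right_mono) auto
    ultimately show "?h x \<le> share \<rho> w z" by (rule share_mono[OF assms(1)])
  qed
  ultimately show ?thesis using assms(3) by simp
qed

lemma potential_eq_0:
  assumes "0 \<le> \<rho>"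
  shows "potential \<rho> m \<lceil>real_of_int c / real m\<rceil> c = 0"
  unfolding potential_def
proof (intro sum.neutral ballI share_eq_0 assms)
  fix x assume "x \<in> {1..c}"
  then show "\<lceil>real_of_int x / real m\<rceil> \<le> \<lceil>real_of_int c / real m\<rceil>"
    by (intro ceiling_mono divide_right_mono) auto
  have "0 \<le> real_of_int x / real m" using \<open>x \<in> {1..c}\<close> by simp
  then show "0 \<le> \<lceil>real_of_int x / real m\<rceil>" by linarith
qed

text \<open>Induction on the number of steps. The level \<open>w\<close> is existential because it
  is determined only at the end of the run; in the base case it is the level of the current
  \<open>c\<close>, where the potential vanishes.\<close>

lemma bricks_loop_lower_bound:
  assumes "1 \<le> \<rho>" "0 < m" "0 \<le> c"
  shows "\<exists>w. 0 \<le> w \<and> w \<le> \<lceil>real_of_int c / real m\<rceil> \<and>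
    real k * real_of_int \<lfloor>real_of_int w * \<rho>\<rfloor> + potential \<rho> m w c
      \<le> real_of_int (sum_list (bricks_loop m \<rho> k c))"
  using assms(3)
proof (induction k arbitrary: c)
  case 0
  have "0 \<le> real_of_int c / real m" using 0 by simp
  then have "0 \<le> \<lceil>real_of_int c / real m\<rceil>" by linarith
  then show ?case
    using potential_eq_0[of \<rho> m c] assms(1) by (intro exI[of _ "\<lceil>real_of_int c / real m\<rceil>"]) auto
next
  case (Suc k)
  define z where "z = \<lceil>real_of_int c / real m\<rceil>"
  have "0 \<le> real_of_int c / real m" using Suc by simp
  then have z0: "0 \<le> z" unfolding z_def by linarith
  \<comment> \<open>From \<open>1 \<le> m\<close> the cost is at most \<open>c\<close>, so
    \<open>c - z\<close> stays nonnegative and the induction hypothesis applies.\<close>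
  have "real_of_int c * 1 \<le> real_of_int c * real m"
    using Suc.prems assms(2) by (intro mult_left_mono) auto
  then have zc: "z \<le> c"
    using assms(2) by (simp add: z_def ceiling_le_iff divide_le_eq)
  obtain w where w: "0 \<le> w" "w \<le> \<lceil>real_of_int (c - z) / real m\<rceil>"
    and le: "real k * real_of_int \<lfloor>real_of_int w * \<rho>\<rfloor> + potential \<rho> m w (c - z)
      \<le> real_of_int (sum_list (bricks_loop m \<rho> k (c - z)))"
    using Suc.IH[of "c - z"] zc by auto
  \<comment> \<open>Levels never rise during the run, so the final level is at most the current
    cost, as \<open>share_surplus\<close> requires.\<close>
  have "\<lceil>real_of_int (c - z) / real m\<rceil> \<le> z"
    unfolding z_def using z0 z_def by (intro ceiling_mono divide_right_mono) auto
  with w have wz: "w \<le> z" by simp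
  have "real_of_int (sum_list (bricks_loop m \<rho> (Suc k) c)) =
      real_of_int \<lfloor>real_of_int z * \<rho>\<rfloor> + real_of_int (sum_list (bricks_loop m \<rho> k (c - z)))"
    by (simp add: z_def Let_def)
  moreover have "real (Suc k) * real_of_int \<lfloor>real_of_int w * \<rho>\<rfloor> =
      real k * real_of_int \<lfloor>real_of_int w * \<rho>\<rfloor> + real_of_int \<lfloor>real_of_int w * \<rho>\<rfloor>"
    by (simp add: algebra_simps)
  ultimately have "real (Suc k) * real_of_int \<lfloor>real_of_int w * \<rho>\<rfloor> + potential \<rho> m w c
      \<le> real_of_int (sum_list (bricks_loop m \<rho> (Suc k) c))"
    using le potential_step[OF assms(1,2) z0 zc z_def, of w] share_surplus[of \<rho> w z] assms(1) w wz
    by linarith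
  then show ?case using w wz z_def by auto
qed

text \<open>Each level is attained by exactly \<open>m\<close> consecutive units.\<close>

lemma sum_levels:
  fixes h :: "int \<Rightarrow> real"
  assumes "0 < m"
  shows "(\<Sum>x\<in>{1..int (L * m)}. h \<lceil>real_of_int x / real m\<rceil>) = real m * (\<Sum>z\<in>{1..int L}. h z)"
proof (induction L)
  case (Suc L)
  let ?g = "\<lambda>x. h \<lceil>real_of_int x / real m\<rceil>"
  have "int (L * m) \<le> int (Suc L * m)" "0 \<le> int (L * m)" by simp_all
  then have "{1..int (Suc L * m)} = {1..int (L * m)} \<union> {int (L * m) + 1..int (Suc L * m)}"
    by (simp only: set_eq_iff Un_iff atLeastAtMost_iff) linarith
  then have "sum ?g {1..int (Suc L * m)} =
      sum ?g {1..int (L * m)} + sum ?g {int (L * m) + 1..int (Suc L * m)}"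
    by (simp add: sum.union_disjoint)
  also have "sum ?g {int (L * m) + 1..int (Suc L * m)} =
      (\<Sum>x\<in>{int (L * m) + 1..int (Suc L * m)}. h (int L + 1))"
  proof (rule sum.cong[OF refl])
    fix x assume x: "x \<in> {int (L * m) + 1..int (Suc L * m)}"
    have "real_of_int (int (L * m) + 1) \<le> real_of_int x"
      and "real_of_int x \<le> real_of_int (int (Suc L * m))"
      using x by (simp_all only: of_int_le_iff atLeastAtMost_iff)
    then have "\<lceil>real_of_int x / real m\<rceil> = int L + 1"
      using assms by (intro ceiling_unique) (simp_all add: field_simps)
    then show "?g x = h (int L + 1)" by simp
  qed
  also have "\<dots> = real m * h (int L + 1)" by simp
  also have "{1..int (Suc L)} = insert (int L + 1) {1..int L}" by auto
  then have "real m * (\<Sum>z\<in>{1..int (Suc L)}. h z) =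
      real m * (\<Sum>z\<in>{1..int L}. h z) + real m * h (int L + 1)"
    by (simp add: algebra_simps)
  ultimately show ?case using Suc.IH by simp
qed simp

text \<open>Each unit falls short of 1 by a nonnegative amount, so the total shortfall can only grow
  when the range is extended to \<open>L\<close> full levels.\<close>

lemma potential_lower_bound:
  assumes "0 < m" "c \<le> int (L * m)"
  shows "real_of_int c - real m * (real L - (\<Sum>z\<in>{1..int L}. share \<rho> w z)) \<le> potential \<rho> m w c"
proof (cases "0 \<le> c")
  case True
  let ?g = "\<lambda>x. 1 - share \<rho> w \<lceil>real_of_int x / real m\<rceil>"
  have "real_of_int c - potential \<rho> m w c = sum ?g {1..c}"
    using True by (simp add: potential_def sum_subtractf)
  also have "\<dots> \<le> sum ?g {1..int (L * m)}"
    using assms by (intro sum_mono2) (auto simp: share_le_1)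
  also have "\<dots> = real m * (\<Sum>z\<in>{1..int L}. 1 - share \<rho> w z)"
    by (rule sum_levels[OF assms(1)])
  also have "\<dots> = real m * (real L - (\<Sum>z\<in>{1..int L}. share \<rho> w z))"
    by (simp add: sum_subtractf)
  finally show ?thesis by simp
next
  case False
  have "(\<Sum>z\<in>{1..int L}. share \<rho> w z) \<le> real (card {1..int L}) * 1"
    by (rule sum_bounded_above) (rule share_le_1)
  then have "0 \<le> real m * (real L - (\<Sum>z\<in>{1..int L}. share \<rho> w z))" by simp
  moreover have "potential \<rho> m w c = 0" using False by (simp add: potential_def)
  ultimately show ?thesis using False by simp
qed

section \<open>Numerical verification for factor 1.6 and levels up to 60\<close>

lemma floor_8_5: "\<lfloor>real_of_int z * 1.6\<rfloor> = 8 * z div 5"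
proof -
  have "real_of_int z * 1.6 = real_of_int (8 * z) / real_of_int 5" by simp
  then show ?thesis by (simp only: floor_divide_of_int_eq)
qed

text \<open>An integer stand-in for \<open>1000 * share 1.6 w z\<close>, rounded down so that it
  remains a lower bound and can be evaluated without reals.\<close>

definition scaled_share :: "int \<Rightarrow> int \<Rightarrow> int" where
  "scaled_share w z = (let d = 8 * z div 5 - 8 * w div 5
     in if d \<le> 0 then 0 else if z \<le> d then 1000 else 1000 * d div z)"

lemma scaled_share_le:
  assumes "0 < z"
  shows "real_of_int (scaled_share w z) \<le> 1000 * share 1.6 w z"
proof -
  define d where "d = 8 * z div 5 - 8 * w div 5"
  have s: "share 1.6 w z = max 0 (min 1 (real_of_int d / real_of_int z))"
    by (simp only: share_def floor_8_5 d_def)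
  have z: "0 < real_of_int z" using assms by simp
  consider "d \<le> 0" | "0 < d" "z \<le> d" | "0 < d" "d < z" by linarith
  then show ?thesis
  proof cases
    case 1
    then show ?thesis unfolding s by (simp add: scaled_share_def flip: d_def)
  next
    case 2
    then have "1 \<le> real_of_int d / real_of_int z" using z by simp
    then show ?thesis unfolding s using 2 by (simp add: scaled_share_def flip: d_def)
  next
    case 3
    then have "scaled_share w z = 1000 * d div z"
      by (simp add: scaled_share_def Let_def flip: d_def)
    moreover have "real_of_int (1000 * d div z) \<le> real_of_int (1000 * d) / real_of_int z"
      by (metis floor_divide_of_int_eq of_int_floor_le)
    moreover have "share 1.6 w z = real_of_int d / real_of_int z"
      unfolding s using 3 z by simp
    ultimately show ?thesis by simp
  qed
qed

text \<open>The worst case \<open>n = 60 * m\<close>, divided by \<open>m\<close> and scaled by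
  1000: the shares of all 60 levels must cover what the credit for level \<open>w\<close> leaves of
  60. Only 61 values of \<open>w\<close> occur, so evaluation decides it.\<close>

lemma scaled_share_sum:
  "list_all (\<lambda>w. 1000 * (60 - 8 * w div 5) \<le> (\<Sum>z\<leftarrow>[1..60]. scaled_share w z)) [0..60]"
  by code_simp

lemma share_sum:
  assumes "0 \<le> w" "w \<le> 60"
  shows "60 - real_of_int (8 * w div 5) \<le> (\<Sum>z\<in>{1..60}. share 1.6 w z)"
proof -
  have "w \<in> set [0..60]" using assms by simp
  then have "1000 * (60 - 8 * w div 5) \<le> (\<Sum>z\<leftarrow>[1..60]. scaled_share w z)"
    using scaled_share_sum unfolding list_all_iff by blast
  also have "\<dots> = sum (scaled_share w) {1..60}"
    by (simp only: sum_list_distinct_conv_sum_set distinct_upto set_upto)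
  finally have "real_of_int (1000 * (60 - 8 * w div 5)) \<le> real_of_int (sum (scaled_share w) {1..60})"
    by (simp only: of_int_le_iff)
  also have "\<dots> = (\<Sum>z\<in>{1..60}. real_of_int (scaled_share w z))" by (rule of_int_sum)
  also have "\<dots> \<le> (\<Sum>z\<in>{1..60}. 1000 * share 1.6 w z)"
    by (intro sum_mono scaled_share_le) simp
  also have "\<dots> = 1000 * (\<Sum>z\<in>{1..60}. share 1.6 w z)" by (rule sum_distrib_left[symmetric])
  finally show ?thesis by simp
qed

theorem theorem14:
  fixes n m b :: nat and \<rho> :: real
  assumes "n > 0" and "m > 0"
    and "real n / real m \<le> 60"
    and "b = m" and "\<rho> = 1.6"
  shows "sum_list (bricks n m b \<rho>) \<ge> int n"
proof -
  have "real n \<le> real (60 * m)" using assms(2,3) by (simp add: field_simps)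
  then have n: "int n \<le> int (60 * m)" by linarith
  obtain w where w: "0 \<le> w" "w \<le> \<lceil>real_of_int (int n) / real m\<rceil>"
    and le: "real m * real_of_int \<lfloor>real_of_int w * 1.6\<rfloor> + potential 1.6 m w (int n)
      \<le> real_of_int (sum_list (bricks_loop m 1.6 m (int n)))"
    using bricks_loop_lower_bound[of "1.6" m "int n" m] assms(2) by auto
  have "\<lceil>real_of_int (int n) / real m\<rceil> \<le> 60" using assms(3) by (simp add: ceiling_le_iff)
  with w(2) have "w \<le> 60" by (rule order_trans)
  \<comment> \<open>Because there are \<open>m\<close> bags, the total credit is \<open>m\<close>
    times the floor of \<open>1.6 * w\<close>; this is at least the shortfall of the potential below
    \<open>n\<close>.\<close>
  from share_sum[OF w(1) this]
  have "real m * (60 - (\<Sum>z\<in>{1..60}. share 1.6 w z)) \<le> real m * real_of_int (8 * w div 5)"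
    by (intro mult_left_mono) auto
  then have "real_of_int (int n) \<le> real_of_int (sum_list (bricks_loop m 1.6 m (int n)))"
    using le potential_lower_bound[OF assms(2) n, of "1.6" w] unfolding floor_8_5 by simp
  then show ?thesis unfolding bricks_def assms(4,5) of_int_le_iff .
qed

end
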